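(* Let $r\ge 1$ be an integer and let $M=\mathbb{Z}_2^r$, regarded as a $\mathbb{Z}_2$-module. Then $C_{\mathbf 1,\mathbf 1}(M)=2^{r+1}$, $D_{\mathbf 1,\mathbf 1}(M)=r+2$, and $E_{\mathbf 1,\mathbf 1}(M)=2^r+r$.
   Context: $\mathbb{Z}_2=\mathbb{Z}/2\mathbb{Z}$. A sequence of length $k$ in $M$ is an element of $M^k$. A subsequence is obtained by selecting terms at some positions and is always nonempty. In a subsequence of consecutive terms, the selected positions are consecutive. A sequence $(x_1,\ldots,x_k)$ in $M$ is a $(\mathbf 1,\mathbf 1)$-weighted zero-sum sequence (where $\mathbf 1=\{1\}\subseteq\mathbb{Z}_2$) if $x_1+\cdots+x_k=0$ in $M$ and the sum of $k$ copies of $1$ is $0$ in $\mathbb{Z}_2$. $D_{\mathbf 1,\mathbf 1}(M)$ is the least positive integer $k$ such that every sequence of length $k$ in $M$ has a $(\mathbf 1,\mathbf 1)$-weighted zero-sum subsequence. $C_{\mathbf 1,\mathbf 1}(M)$ is the least positive integer $k$ such that every sequence of length $k$ in $M$ has a $(\mathbf 1,\mathbf 1)$-weighted zero-sum subsequence of consecutive terms. $E_{\mathbf 1,\mathbf 1}(M)$ is the least positive integer $k$ such that every sequence of length $k$ in $M$ has a $(\mathbf 1,\mathbf 1)$-weighted zero-sum subsequence of length $|M|$. *)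

theory Defs
  imports "HOL-Analysis.Finite_Cartesian_Product" "HOL-Library.Z2" "HOL-Library.Sublist"
begin

instance bit :: finite
proof
  have "(UNIV :: bit set) \<subseteq> {0, 1}"
    using bit_not_zero_iff by blast
  then show "finite (UNIV :: bit set)"
    using finite_subset by blast
qed

(* (A,B)-weighted zero-sum sequences for A = B = {1}: every weight is 1, so the scalar action of
   Z_2 on M does not occur.  The constants below are D, C and E for this pair of weight sets. *)
definition zero_sum_seq :: "'m::ab_group_add list \<Rightarrow> bool" where
  "zero_sum_seq xs \<longleftrightarrow>
     sum_list xs = 0 \<and> sum_list (replicate (length xs) (1 :: bit)) = 0"

(* The infima below range over sets of naturals, where Inf of the empty set is 0 and Inf of a
   nonempty set is its least element.  A positive value therefore means that it is attained. *)

definition davenport_const :: "'m::ab_group_add itself \<Rightarrow> nat" where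
  "davenport_const _ = Inf {k. k > 0 \<and>
     (\<forall>xs :: 'm list. length xs = k \<longrightarrow>
        (\<exists>ys. subseq ys xs \<and> ys \<noteq> [] \<and> zero_sum_seq ys))}"

definition consecutive_const :: "'m::ab_group_add itself \<Rightarrow> nat" where
  "consecutive_const _ = Inf {k. k > 0 \<and>
     (\<forall>xs :: 'm list. length xs = k \<longrightarrow>
        (\<exists>ys. sublist ys xs \<and> ys \<noteq> [] \<and> zero_sum_seq ys))}"

definition gao_const :: "'m::{finite, ab_group_add} itself \<Rightarrow> nat" where
  "gao_const _ = Inf {k. k > 0 \<and>
     (\<forall>xs :: 'm list. length xs = k \<longrightarrow>
        (\<exists>ys. subseq ys xs \<and> ys \<noteq> [] \<and> zero_sum_seq ys \<and> length ys = CARD('m)))}"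

end

theory Submission
  imports Defs
begin

text \<open>
  Since every term of a sequence counts \<open>1\<close> in \<open>\<int>\<^sub>2\<close>, the zero-sum condition asks for sum zero and
  even length. It is the ordinary zero-sum condition for the elements \<open>(x, 1)\<close> of \<open>M \<times> \<int>\<^sub>2\<close>,
  a group of order \<open>2 * CARD('m)\<close>, and all three constants come from counting in that group.

  For consecutive terms, the \<open>2 * CARD('m) + 1\<close> prefix sums of a sequence of length
  \<open>2 * CARD('m)\<close> cannot be distinct in \<open>M \<times> \<int>\<^sub>2\<close> (\<open>consecutive_upper\<close>). Conversely, a walk that
  visits every element of \<open>M \<times> \<int>\<^sub>2\<close> exactly once gives a sequence one term shorter with no
  solution (\<open>consecutive_lower\<close>). This part holds in every finite abelian group.

  When \<open>x + x = 0\<close> throughout \<open>M\<close> and \<open>M\<close> has order \<open>2 ^ r\<close>, a set of \<open>r + 2\<close> positions has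
  \<open>2 ^ (r + 2)\<close> subsets, so that two of them agree in sum and in parity of size. Their symmetric
  difference is then an even zero-sum subset (\<open>ex_even_zero_sum_subset\<close>), which bounds the
  constant for arbitrary subsequences from above.

  For subsequences of length \<open>2 ^ r\<close>, a largest even zero-sum set of positions
  misses at most \<open>r + 1\<close> positions, because otherwise the missed ones would contain another
  such set (\<open>ex_large_even_zero_sum_subset\<close>). In a sequence of length \<open>2 ^ r + r\<close> it therefore
  has at least \<open>2 ^ r - 1\<close> elements, hence at least \<open>2 ^ r\<close> by parity. While it has more than
  \<open>2 ^ r\<close> elements, two of its terms are equal, and dropping them leaves the sum zero
  (\<open>shrink_zero_sum_subset\<close>); as sizes fall by two, this reaches \<open>2 ^ r\<close> exactly.

  Both lower bounds for \<open>\<int>\<^sub>2\<^sup>r\<close> use zeros followed by the unit vectors: these are independent, so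
  that only the zeros can take part in a zero-sum subsequence (\<open>zero_sum_subseq_zeros_units\<close>).
  One zero serves for arbitrary subsequences and \<open>2 ^ r - 1\<close> zeros for those of length \<open>2 ^ r\<close>.
\<close>

section \<open>Parity of length and least admissible lengths\<close>

lemma zero_sum_seq_iff: "zero_sum_seq xs \<longleftrightarrow> sum_list xs = 0 \<and> even (length xs)"
proof -
  have "sum_list (replicate n (1 :: bit)) = 0 \<longleftrightarrow> even n" for n
    by (induction n) auto
  then show ?thesis
    by (simp add: zero_sum_seq_def)
qed

text \<open>
  A single sequence of length \<open>n\<close> without the property excludes all the smaller lengths as well,
  since its prefixes lack the property too.
\<close>

lemma Inf_length_eqI:
  fixes Q :: "'a list \<Rightarrow> bool"
  assumes good: "\<And>xs. length xs = Suc n \<Longrightarrow> Q xs"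
    and bad: "length ws = n" "\<not> Q ws"
    and prefix: "\<And>k xs. Q (take k xs) \<Longrightarrow> Q xs"
  shows "Inf {k. k > 0 \<and> (\<forall>xs. length xs = k \<longrightarrow> Q xs)} = Suc n"
proof (rule cInf_eq_minimum)
  show "Suc n \<in> {k. k > 0 \<and> (\<forall>xs. length xs = k \<longrightarrow> Q xs)}"
    using good by simp
next
  fix k
  assume k: "k \<in> {k. k > 0 \<and> (\<forall>xs. length xs = k \<longrightarrow> Q xs)}"
  show "Suc n \<le> k"
  proof (rule ccontr)
    assume "\<not> Suc n \<le> k"
    then have "length (take k ws) = k"
      using bad by simp
    then show False
      using k prefix bad by blast
  qed
qed

section \<open>Consecutive terms\<close>

lemma sum_list_take_drop:
  fixes xs :: "'m::ab_group_add list"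
  assumes "i \<le> j"
  shows "sum_list (take (j - i) (drop i xs)) = sum_list (take j xs) - sum_list (take i xs)"
proof -
  have "take j xs = take i xs @ take (j - i) (drop i xs)"
    using assms by (metis le_add_diff_inverse take_add)
  then show ?thesis
    by simp
qed

lemma consecutive_upper:
  fixes xs :: "'m::{finite, ab_group_add} list"
  assumes len: "length xs = 2 * CARD('m)"
  shows "\<exists>ys. sublist ys xs \<and> ys \<noteq> [] \<and> zero_sum_seq ys"
proof -
  define g where "g k = (sum_list (take k xs), even k)" for k
  have "card (g ` {..length xs}) < card {..length xs}"
    using card_mono[of "UNIV :: ('m \<times> bool) set" "g ` {..length xs}"]
    by (simp add: len card_prod)
  then have "\<not> inj_on g {..length xs}"
    by (rule pigeonhole)
  then obtain i j where ij: "i < j" "j \<le> length xs" "g i = g j"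
    by (metis atMost_iff linorder_inj_onI')
  define ys where "ys = take (j - i) (drop i xs)"
  have len_ys: "length ys = j - i"
    using ij by (simp add: ys_def)
  have "sum_list ys = 0"
    using ij sum_list_take_drop[of i j xs] by (simp add: ys_def g_def)
  moreover have "even (length ys)"
    using ij len_ys by (simp add: g_def)
  moreover have "sublist ys xs"
    unfolding ys_def by (rule sublist_order.order.trans[OF sublist_take sublist_drop])
  ultimately show ?thesis
    using len_ys ij by (auto simp: zero_sum_seq_iff)
qed

text \<open>
  Up to a translation, the partial sums of \<open>ws\<close> follow a walk that visits each element of \<open>M\<close> at
  two successive times, one even and one odd. Two times of equal parity are then never at the same element,
  which rules out a zero-sum block of even length.
\<close>

lemma consecutive_lower:
  "\<exists>ws :: 'm::{finite, ab_group_add} list. length ws = 2 * CARD('m) - 1 \<and>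
     (\<nexists>ys. sublist ys ws \<and> ys \<noteq> [] \<and> zero_sum_seq ys)"
proof -
  obtain e :: "nat \<Rightarrow> 'm" where e: "bij_betw e {0..<CARD('m)} UNIV"
    using ex_bij_betw_nat_finite finite_class.finite_UNIV by blast
  define p where "p i = e (i div 2)" for i
  define ws where "ws = map (\<lambda>i. p (Suc i) - p i) [0..<2 * CARD('m) - 1]"
  have len: "length ws = 2 * CARD('m) - 1"
    by (simp add: ws_def)
  have pre: "sum_list (take k ws) = p k - p 0" if "k \<le> length ws" for k
    using that
  proof (induction k)
    case (Suc k)
    then show ?case
      by (simp add: take_Suc_conv_app_nth) (simp add: ws_def)
  qed simp
  have False if ys: "sublist ys ws" "ys \<noteq> []" "zero_sum_seq ys" for ys
  proof -
    obtain as bs where dec: "ws = as @ ys @ bs"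
      using ys(1) by (auto simp: sublist_def)
    define i j where "i = length as" and "j = length as + length ys"
    have j: "i < j" "j \<le> length ws"
      using ys(2) by (simp_all add: i_def j_def dec)
    have "take i ws = as" "take j ws = as @ ys"
      by (simp_all add: dec i_def j_def)
    then have "p i = p j"
      using pre[of i] pre[of j] j ys(3) by (simp add: zero_sum_seq_iff)
    moreover have "i div 2 < CARD('m)" "j div 2 < CARD('m)"
      using j len by auto
    ultimately have "i div 2 = j div 2"
      using e by (auto simp: p_def bij_betw_def inj_on_def)
    moreover have "even (j - i)"
      using ys(3) by (simp add: i_def j_def zero_sum_seq_iff)
    ultimately show False
      using j(1) by presburger
  qed
  with len show ?thesis
    by blast
qed

theorem consecutive_const_eq:
  "consecutive_const TYPE('m::{finite, ab_group_add}) = 2 * CARD('m)"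
proof -
  obtain ws :: "'m list" where ws: "length ws = 2 * CARD('m) - 1"
    "\<nexists>ys. sublist ys ws \<and> ys \<noteq> [] \<and> zero_sum_seq ys"
    using consecutive_lower by blast
  have "CARD('m) > 0"
    by simp
  then have Suc: "Suc (2 * CARD('m) - 1) = 2 * CARD('m)"
    by linarith
  have "Inf {k. k > 0 \<and> (\<forall>xs :: 'm list. length xs = k \<longrightarrow>
      (\<exists>ys. sublist ys xs \<and> ys \<noteq> [] \<and> zero_sum_seq ys))} = Suc (2 * CARD('m) - 1)"
  proof (rule Inf_length_eqI[where ws = ws])
    show "\<exists>ys. sublist ys xs \<and> ys \<noteq> [] \<and> zero_sum_seq ys"
      if "length xs = Suc (2 * CARD('m) - 1)" for xs :: "'m list"
      using that consecutive_upper unfolding Suc by blast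
  qed (use ws sublist_order.order.trans[OF _ sublist_take] in blast)+
  then show ?thesis
    by (simp only: consecutive_const_def Suc)
qed

section \<open>Zero-sum subsequences in groups of exponent two\<close>

lemma sum_symm_diff:
  fixes f :: "'i \<Rightarrow> 'm::ab_group_add"
  assumes two: "\<And>x :: 'm. x + x = 0" and "finite A" "finite B"
  shows "sum f (sym_diff A B) = sum f A + sum f B"
proof -
  have "sum f A + sum f B = sum f (sym_diff A B) + (sum f (A \<inter> B) + sum f (A \<inter> B))"
    using assms(2,3)
    by (simp add: sum.union_disjoint Diff_Int_distrib2 Int_Diff
        sum.Int_Diff[of A f B] sum.Int_Diff[of B f A] Int_commute algebra_simps Diff_disjoint)
  then show ?thesis
    by (simp add: two)
qed

lemma even_card_symm_diff:
  assumes "finite A" "finite B"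
  shows "even (card (sym_diff A B)) \<longleftrightarrow> (even (card A) \<longleftrightarrow> even (card B))"
proof -
  have "card (sym_diff A B) = card (A - B) + card (B - A)"
    using assms by (intro card_Un_disjoint) auto
  moreover have "card A = card (A - B) + card (A \<inter> B)" "card B = card (B - A) + card (A \<inter> B)"
    using assms card_Diff_subset_Int[of A B] card_Diff_subset_Int[of B A]
      card_mono[of A "A \<inter> B"] card_mono[of B "A \<inter> B"] by (auto simp: Int_commute)
  ultimately show ?thesis
    by (metis even_add)
qed

text \<open>
  Pigeonhole on subsets takes the place of linear dependence: in exponent two, the symmetric
  difference of two distinct sets with equal sum and equal parity is an even zero-sum set.
\<close>

lemma ex_even_zero_sum_subset:
  fixes f :: "'i \<Rightarrow> 'm::{finite, ab_group_add}"
  assumes two: "\<And>x :: 'm. x + x = 0" and card_M: "CARD('m) = 2 ^ r"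
    and I: "finite I" "r + 2 \<le> card I"
  shows "\<exists>J \<subseteq> I. J \<noteq> {} \<and> even (card J) \<and> sum f J = 0"
proof -
  define g where "g J = (sum f J, even (card J))" for J
  have "card (g ` Pow I) \<le> card (UNIV :: ('m \<times> bool) set)"
    by (rule card_mono) auto
  also have "\<dots> = 2 ^ (r + 1)"
    by (simp add: card_prod card_M)
  also have "\<dots> < (2::nat) ^ card I"
    using I by (intro power_strict_increasing) auto
  also have "\<dots> = card (Pow I)"
    using I by (simp add: card_Pow)
  finally have "\<not> inj_on g (Pow I)"
    by (rule pigeonhole)
  then obtain A B where AB: "A \<subseteq> I" "B \<subseteq> I" "A \<noteq> B" "g A = g B"
    by (auto simp: inj_on_def)
  then have fin: "finite A" "finite B"
    using I finite_subset by auto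
  have "sum f (sym_diff A B) = 0"
    using AB by (simp add: sum_symm_diff[OF two fin] g_def two)
  moreover have "even (card (sym_diff A B))"
    using AB by (simp add: even_card_symm_diff[OF fin] g_def)
  moreover have "sym_diff A B \<subseteq> I" "sym_diff A B \<noteq> {}"
    using AB by auto
  ultimately show ?thesis
    by blast
qed

text \<open>
  If a set \<open>J\<close> of largest size missed \<open>r + 2\<close> positions, then these would contain a nonempty even
  zero-sum set, and its union with \<open>J\<close> would be larger.
\<close>

lemma ex_large_even_zero_sum_subset:
  fixes f :: "'i \<Rightarrow> 'm::{finite, ab_group_add}"
  assumes two: "\<And>x :: 'm. x + x = 0" and card_M: "CARD('m) = 2 ^ r"
    and I: "finite I"
  shows "\<exists>J \<subseteq> I. even (card J) \<and> sum f J = 0 \<and> card I \<le> card J + r + 1"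
proof -
  define P where "P J \<longleftrightarrow> J \<subseteq> I \<and> even (card J) \<and> sum f J = 0" for J
  have "P {}"
    by (simp add: P_def)
  moreover have bound: "card J \<le> card I" if "P J" for J
    using that I by (auto simp: P_def intro: card_mono)
  ultimately obtain J where J: "P J" "\<And>K. P K \<Longrightarrow> card K \<le> card J"
    using ex_has_greatest_nat[of P "{}" card "Suc (card I)"] by (auto simp: less_Suc_eq_le)
  have finJ: "finite J" and sub: "J \<subseteq> I"
    using J I finite_subset by (auto simp: P_def)
  have "card (I - J) < r + 2"
  proof (rule ccontr)
    assume "\<not> card (I - J) < r + 2"
    then obtain K where K: "K \<subseteq> I - J" "K \<noteq> {}" "even (card K)" "sum f K = 0"
      using ex_even_zero_sum_subset[OF two card_M, of "I - J" f] I by auto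
    then have finK: "finite K" and disj: "J \<inter> K = {}"
      using I finite_subset by auto
    have card: "card (J \<union> K) = card J + card K"
      using finJ finK disj by (rule card_Un_disjoint)
    have "P (J \<union> K)"
      using J(1) K card disj finJ finK by (auto simp: P_def sum.union_disjoint)
    then show False
      using J(2)[of "J \<union> K"] card K finK by (simp add: card_gt_0_iff)
  qed
  moreover have "card (I - J) = card I - card J"
    using finJ sub by (rule card_Diff_subset)
  ultimately show ?thesis
    using J(1) by (intro exI[of _ J]) (auto simp: P_def)
qed

text \<open>
  A set of more than \<open>CARD('m)\<close> positions carries two equal terms, whose sum is zero. The sizes
  stay even, so removing such pairs cannot jump over the even number \<open>CARD('m)\<close>.
\<close>

lemma shrink_zero_sum_subset:
  fixes f :: "'i \<Rightarrow> 'm::{finite, ab_group_add}"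
  assumes two: "\<And>x :: 'm. x + x = 0" and "even CARD('m)"
    and "finite J" "even (card J)" "sum f J = 0" "CARD('m) \<le> card J"
  shows "\<exists>K \<subseteq> J. card K = CARD('m) \<and> sum f K = 0"
  using assms(3-6)
proof (induction "card J" arbitrary: J rule: less_induct)
  case less
  show ?case
  proof (cases "card J = CARD('m)")
    case True
    then show ?thesis
      using less.prems by blast
  next
    case False
    then have large: "CARD('m) < card J"
      using less.prems by simp
    then have "card (f ` J) < card J"
      using card_mono[of UNIV "f ` J"] by simp
    then have "\<not> inj_on f J"
      by (rule pigeonhole)
    then obtain a b where ab: "a \<in> J" "b \<in> J" "a \<noteq> b" "f a = f b"
      by (auto simp: inj_on_def)
    define J' where "J' = J - {a, b}"
    have "card J' = card J - 2"
      using ab less.prems by (simp add: J'_def card_Diff_subset)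
    moreover have "card J \<ge> CARD('m) + 2"
      using large less.prems(2) \<open>even CARD('m)\<close> by presburger
    ultimately have card: "card J' < card J" "even (card J')" "CARD('m) \<le> card J'"
      using less.prems(2) by auto
    have "sum f J = sum f J' + sum f {a, b}"
      unfolding J'_def using ab less.prems(1) by (intro sum.subset_diff) auto
    then have "sum f J' = 0"
      using ab less.prems(3) by (simp add: two)
    then obtain K where "K \<subseteq> J'" "card K = CARD('m)" "sum f K = 0"
      using less.hyps[of J'] card less.prems(1) by (auto simp: J'_def)
    then show ?thesis
      by (auto simp: J'_def)
  qed
qed

text \<open>
  Unions and differences are easier to form for sets of positions than for subsequences;
  this lemma turns the resulting set back into a subsequence.
\<close>

lemma ex_subseq_sum:
  fixes xs :: "'m::comm_monoid_add list"
  assumes "J \<subseteq> {..<length xs}"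
  shows "\<exists>ys. subseq ys xs \<and> length ys = card J \<and> sum_list ys = (\<Sum>i\<in>J. xs ! i)"
proof -
  define js where "js = filter (\<lambda>i. i \<in> J) [0..<length xs]"
  have js: "distinct js" "set js = J"
    using assms by (auto simp: js_def)
  define ys where "ys = map ((!) xs) js"
  have "subseq ys (map ((!) xs) [0..<length xs])"
    unfolding ys_def js_def by (intro subseq_map subseq_filter_left)
  then have "subseq ys xs"
    by (simp add: map_nth)
  moreover have "length ys = card J"
    using js distinct_card[of js] by (simp add: ys_def)
  moreover have "sum_list ys = (\<Sum>i\<in>J. xs ! i)"
    using js by (simp add: ys_def sum_list_distinct_conv_sum_set)
  ultimately show ?thesis
    by blast
qed

lemma davenport_upper:
  fixes xs :: "'m::{finite, ab_group_add} list"
  assumes two: "\<And>x :: 'm. x + x = 0" and card_M: "CARD('m) = 2 ^ r"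
    and len: "length xs = r + 2"
  shows "\<exists>ys. subseq ys xs \<and> ys \<noteq> [] \<and> zero_sum_seq ys"
proof -
  obtain J where J: "J \<subseteq> {..<length xs}" "J \<noteq> {}" "even (card J)" "(\<Sum>i\<in>J. xs ! i) = 0"
    using ex_even_zero_sum_subset[OF two card_M, of "{..<length xs}" "(!) xs"] len by auto
  obtain ys where ys: "subseq ys xs" "length ys = card J" "sum_list ys = (\<Sum>i\<in>J. xs ! i)"
    using ex_subseq_sum[OF J(1)] by blast
  have "card J \<noteq> 0"
    using J(1,2) finite_subset by fastforce
  then show ?thesis
    using ys J by (auto simp: zero_sum_seq_iff)
qed

lemma gao_upper:
  fixes xs :: "'m::{finite, ab_group_add} list"
  assumes two: "\<And>x :: 'm. x + x = 0" and card_M: "CARD('m) = 2 ^ r" and "r \<ge> 1"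
    and len: "length xs = 2 ^ r + r"
  shows "\<exists>ys. subseq ys xs \<and> ys \<noteq> [] \<and> zero_sum_seq ys \<and> length ys = CARD('m)"
proof -
  have even: "even CARD('m)"
    using \<open>r \<ge> 1\<close> by (simp add: card_M)
  obtain J where J: "J \<subseteq> {..<length xs}" "even (card J)" "(\<Sum>i\<in>J. xs ! i) = 0"
    "length xs \<le> card J + r + 1"
    using ex_large_even_zero_sum_subset[OF two card_M, of "{..<length xs}" "(!) xs"] by auto
  have "CARD('m) \<le> card J + 1"
    using J(4) by (simp add: len card_M)
  \<comment> \<open>\<open>card J = CARD('m) - 1\<close> is impossible, as this number is odd.\<close>
  then have "CARD('m) \<le> card J"
    using J(2) even by presburger
  then obtain K where K: "K \<subseteq> J" "card K = CARD('m)" "(\<Sum>i\<in>K. xs ! i) = 0"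
    using shrink_zero_sum_subset[OF two even _ J(2,3)] J(1) finite_subset by blast
  obtain ys where "subseq ys xs" "length ys = card K" "sum_list ys = (\<Sum>i\<in>K. xs ! i)"
    using ex_subseq_sum[of K xs] K(1) J(1) by blast
  then show ?thesis
    using K even by (intro exI[of _ ys]) (auto simp: zero_sum_seq_iff)
qed

section \<open>Extremal sequences\<close>

text \<open>
  The unit vectors chosen by a subsequence are distinct. If the one of index \<open>j\<close> is chosen, the
  sum has coordinate \<open>1\<close> at \<open>j\<close>; so a zero-sum subsequence consists of zeros only.
\<close>

lemma zero_sum_subseq_zeros_units:
  fixes ys :: "(bit ^ 'n) list"
  assumes "subseq ys (replicate k 0 @ map (\<lambda>i. axis i 1) ks)" "distinct ks" "sum_list ys = 0"
  shows "length ys \<le> k"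
proof -
  obtain zs us where ys: "ys = zs @ us" "subseq zs (replicate k 0)"
    "subseq us (map (\<lambda>i. axis i 1) ks)"
    using assms(1) by (auto simp: subseq_append_iff)
  obtain N where "us = nths (map (\<lambda>i. axis i 1) ks) N"
    using ys(3) by (auto simp: subseq_conv_nths)
  then obtain js where js: "us = map (\<lambda>i. axis i 1) js" "distinct js"
    using assms(2) by (auto simp: nths_map)
  have "set zs \<subseteq> {0}"
  proof -
    obtain N where "zs = nths (replicate k 0) N"
      using ys(2) by (auto simp: subseq_conv_nths)
    then show ?thesis
      using set_nths_subset[of "replicate k 0" N]
        by (auto simp: set_replicate_conv_if split: if_splits)
  qed
  then have "sum_list zs = 0"
    by (induction zs) auto
  then have "sum_list us = 0"
    using assms(3) ys(1) by simp
  then have 0: "(\<Sum>i\<in>set js. axis i (1::bit)) = 0"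
    using js(2) by (simp add: js(1) sum_list_distinct_conv_sum_set)
  have "js = []"
  proof (rule ccontr)
    assume "js \<noteq> []"
    then obtain j where "j \<in> set js"
      by (cases js) auto
    then have "(\<Sum>i\<in>set js. axis i (1::bit)) $ j = 1"
      by (simp add: axis_def if_distrib sum.delta cong: if_cong)
    then show False
      by (simp add: 0)
  qed
  then have "length ys = length zs"
    by (simp add: ys(1) js(1))
  also have "\<dots> \<le> k"
    using list_emb_length[OF ys(2)] by simp
  finally show ?thesis .
qed

lemma ex_zeros_units:
  "\<exists>ws :: (bit ^ 'n::finite) list. length ws = k + CARD('n) \<and>
     (\<forall>ys. subseq ys ws \<longrightarrow> sum_list ys = 0 \<longrightarrow> length ys \<le> k)"
proof -
  obtain ks :: "'n list" where "distinct ks" "set ks = UNIV"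
    using finite_distinct_list[OF finite_class.finite_UNIV] by blast
  then show ?thesis
    using zero_sum_subseq_zeros_units[of _ k "ks"] distinct_card[of "ks"]
    by (intro exI[of _ "replicate k 0 @ map (\<lambda>i. axis i 1) ks"]) auto
qed

section \<open>The constants of the elementary abelian two-groups\<close>

lemma card_bit: "CARD(bit) = 2"
proof -
  have "(UNIV :: bit set) = {0, 1}"
    using bit_not_zero_iff by blast
  moreover have "card {0, 1 :: bit} = 2"
    by (subst card_2_iff) auto
  ultimately show ?thesis
    by metis
qed

lemma card_bit_vec: "CARD(bit ^ 'n::finite) = 2 ^ CARD('n)"
  by (simp add: card_bit)

lemma bit_vec_add_self: "x + x = 0" for x :: "bit ^ 'n::finite"
  by (simp add: vec_eq_iff)

lemma subseq_takeD: "subseq ys (take k xs) \<Longrightarrow> subseq ys xs"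
  by (rule subseq_order.order_trans[OF _ prefix_imp_subseq[OF take_is_prefix]])

lemma davenport_const_eq: "davenport_const TYPE(bit ^ 'n::finite) = CARD('n) + 2"
proof -
  obtain ws :: "(bit ^ 'n) list" where ws: "length ws = 1 + CARD('n)"
    "\<And>ys. subseq ys ws \<Longrightarrow> sum_list ys = 0 \<Longrightarrow> length ys \<le> 1"
    using ex_zeros_units[of 1] by blast
  have bad: "\<nexists>ys. subseq ys ws \<and> ys \<noteq> [] \<and> zero_sum_seq ys"
  proof
    assume "\<exists>ys. subseq ys ws \<and> ys \<noteq> [] \<and> zero_sum_seq ys"
    then obtain ys where ys: "subseq ys ws" "ys \<noteq> []" "sum_list ys = 0" "even (length ys)"
      by (auto simp: zero_sum_seq_iff)
    then show False
      using ws(2)[OF ys(1,3)] by (cases ys) auto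
  qed
  have "davenport_const TYPE(bit ^ 'n) = Suc (1 + CARD('n))"
    unfolding davenport_const_def
  proof (rule Inf_length_eqI[where ws = ws])
    show "\<exists>ys. subseq ys xs \<and> ys \<noteq> [] \<and> zero_sum_seq ys" if "length xs = Suc (1 + CARD('n))"
      for xs :: "(bit ^ 'n) list"
      using davenport_upper[OF bit_vec_add_self card_bit_vec] that by simp
  qed (use ws(1) bad subseq_takeD in blast)+
  then show ?thesis
    by simp
qed

lemma gao_const_eq: "gao_const TYPE(bit ^ 'n::finite) = 2 ^ CARD('n) + CARD('n)"
proof -
  obtain ws :: "(bit ^ 'n) list" where ws: "length ws = 2 ^ CARD('n) - 1 + CARD('n)"
    "\<And>ys. subseq ys ws \<Longrightarrow> sum_list ys = 0 \<Longrightarrow> length ys \<le> 2 ^ CARD('n) - 1"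
    using ex_zeros_units[of "2 ^ CARD('n) - 1"] by blast
  have Suc: "Suc (2 ^ CARD('n) - 1 + CARD('n)) = 2 ^ CARD('n) + CARD('n)"
    by simp
  have bad: "\<nexists>ys. subseq ys ws \<and> ys \<noteq> [] \<and> zero_sum_seq ys \<and> length ys = CARD(bit ^ 'n)"
  proof
    assume "\<exists>ys. subseq ys ws \<and> ys \<noteq> [] \<and> zero_sum_seq ys \<and> length ys = CARD(bit ^ 'n)"
    then obtain ys where ys: "subseq ys ws" "sum_list ys = 0" "length ys = 2 ^ CARD('n)"
      by (auto simp: zero_sum_seq_iff card_bit)
    have "(2::nat) ^ CARD('n) > 0"
      by simp
    then show False
      using ws(2)[OF ys(1,2)] ys(3) by linarith
  qed
  have "gao_const TYPE(bit ^ 'n) = Suc (2 ^ CARD('n) - 1 + CARD('n))"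
    unfolding gao_const_def
  proof (rule Inf_length_eqI[where ws = ws])
    show "\<exists>ys. subseq ys xs \<and> ys \<noteq> [] \<and> zero_sum_seq ys \<and> length ys = CARD(bit ^ 'n)"
      if "length xs = Suc (2 ^ CARD('n) - 1 + CARD('n))" for xs :: "(bit ^ 'n) list"
      using gao_upper[OF bit_vec_add_self card_bit_vec] that unfolding Suc by simp
  qed (use ws(1) bad subseq_takeD in blast)+
  then show ?thesis
    unfolding Suc .
qed

theorem mainTheorem3:
  fixes r :: nat
  assumes "r \<ge> 1" and "CARD('n::finite) = r"
  shows "consecutive_const TYPE(bit ^ 'n) = 2 ^ (r + 1)
       \<and> davenport_const TYPE(bit ^ 'n) = r + 2
       \<and> gao_const TYPE(bit ^ 'n) = 2 ^ r + r"
  using assms(2)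
  by (simp add: consecutive_const_eq davenport_const_eq gao_const_eq card_bit)

end
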